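(* Fix $\rho(t)=t^2$ and let $X,Y$ be random $d$-vectors (defined on a common probability space) with respective distributions $P,Q$ in $\mathcal{P}_d$. In (ii) and (iii), the distribution of $X+Y$ is also in $\mathcal{P}_d$. Then the following properties hold: (i) (monotonicity) if $X\leq Y$ almost surely in a componentwise sense, then $H^\rho_{\alpha,u}(Y)\subset H^\rho_{\alpha,u}(X)\oplus\mathbb{R}^d_+$ and $H^\rho_{\alpha,u}(X)\subset H^\rho_{\alpha,u}(Y)\oplus\mathbb{R}^d_-$ for any $\alpha\in(0,1)$ and $u\in\mathcal{S}^{d-1}_+$; (ii) (subadditivity) for any $\alpha\in(0,\frac12]$ and $u\in\mathcal{S}^{d-1}$, $H^\rho_{\alpha,u}(X+Y)\subset H^\rho_{\alpha,u}(X)\oplus H^\rho_{\alpha,u}(Y)$; (iii) (superadditivity) for any $\alpha\in[\frac12,1)$ and $u\in\mathcal{S}^{d-1}$, $H^\rho_{\alpha,u}(X)\oplus H^\rho_{\alpha,u}(Y)\subset H^\rho_{\alpha,u}(X+Y)$; (iv) (nestedness) for any $u\in\mathcal{S}^{d-1}$, $\alpha\mapsto H^\rho_{\alpha,u}(X)$ is non-increasing with respect to inclusion.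
   Context: A prime denotes transposition, $\mathbb{I}[A]$ is the indicator of $A$, $\oplus$ is the Minkowski sum, $\mathcal{S}^{d-1}=\{z\in\mathbb{R}^d:\|z\|=1\}$, $\mathbb{R}^d_\pm=\{x\in\mathbb{R}^d:\pm x_1\geq0,\ldots,\pm x_d\geq0\}$ and $\mathcal{S}^{d-1}_+=\mathcal{S}^{d-1}\cap\mathbb{R}^d_+$. $\mathcal{P}_d$ (which is $\mathcal{P}_d^\rho$ for $\rho(t)=t^2$) is the collection of probability measures over $\mathbb{R}^d$ that do not give probability one to any hyperplane of $\mathbb{R}^d$ (for $d=1$, to any singleton) and that have finite first-order moments. For a random $d$-vector $Z$ with distribution in $\mathcal{P}_d$, $\alpha\in(0,1)$ and $u\in\mathcal{S}^{d-1}$, the order-$\alpha$ expectile of $u'Z$ is $$\theta^\rho_\alpha(u'Z):=\inf\Big\{\theta\in\mathbb{R}:\frac{\mathrm{E}[|u'Z-\theta|\,\mathbb{I}[u'Z\leq\theta]]}{\mathrm{E}[|u'Z-\theta|]}\geq\alpha\Big\},$$ and the expectile halfspace of $Z$ in direction $u$ is $H^\rho_{\alpha,u}(Z)=\{z\in\mathbb{R}^d:u'z\geq\theta^\rho_\alpha(u'Z)\}$. *)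

theory Defs
  imports "HOL-Probability.Probability" "HOL-Library.Set_Algebras"
begin

text \<open>
  \<open>\<real>\<^sup>d\<close> is \<^typ>\<open>real ^ 'n\<close> with \<open>d = CARD('n) \<ge> 1\<close>; the Minkowski sum is the library's
  \<open>+\<close> on sets.
\<close>

definition nonneg_orthant :: "(real ^ 'n) set" where
  "nonneg_orthant = {x. \<forall>i. x $ i \<ge> 0}"

definition nonpos_orthant :: "(real ^ 'n) set" where
  "nonpos_orthant = {x. \<forall>i. - (x $ i) \<ge> 0}"

text \<open>
  For \<open>d = 1\<close> the sets \<open>{z. a \<bullet> z = b}\<close> with \<open>a \<noteq> 0\<close> are exactly the singletons, so that
  case needs no separate clause.
\<close>

definition expectile_class :: "(real ^ 'n) measure set" where
  "expectile_class = {P. prob_space P \<and> sets P = sets borel \<and>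
     (\<forall>a b. a \<noteq> 0 \<longrightarrow> measure P {z. a \<bullet> z = b} \<noteq> 1) \<and>
     integrable P (\<lambda>z. norm z)}"

definition expectile :: "'w measure \<Rightarrow> real \<Rightarrow> ('w \<Rightarrow> real) \<Rightarrow> real" where
  "expectile M \<alpha> V = Inf {\<theta>.
     (\<integral>\<omega>. \<bar>V \<omega> - \<theta>\<bar> * indicator {\<omega>. V \<omega> \<le> \<theta>} \<omega> \<partial>M) / (\<integral>\<omega>. \<bar>V \<omega> - \<theta>\<bar> \<partial>M) \<ge> \<alpha>}"

definition expectile_halfspace ::
    "'w measure \<Rightarrow> real \<Rightarrow> real ^ 'n \<Rightarrow> ('w \<Rightarrow> real ^ 'n) \<Rightarrow> (real ^ 'n) set" where
  "expectile_halfspace M \<alpha> u Z = {z. u \<bullet> z \<ge> expectile M \<alpha> (\<lambda>\<omega>. u \<bullet> Z \<omega>)}"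

end

theory Submission
  imports Defs
begin

text \<open>
  Everything takes place in one dimension. Writing \<open>t\<^sup>+\<close> and \<open>t\<^sup>-\<close> for the positive and negative
  parts of \<open>t\<close> and \<open>\<ell>\<^sub>\<alpha> t = \<alpha> t\<^sup>+ - (1 - \<alpha>) t\<^sup>-\<close>, the inequality that defines the expectile of \<open>V\<close>,
  once multiplied by \<open>E \<bar>V - \<theta>\<bar> > 0\<close>, reads \<open>E \<ell>\<^sub>\<alpha> (V - \<theta>) \<le> 0\<close>: this is the first-order condition
  for minimising the asymmetric squared loss. Since \<open>\<ell>\<^sub>\<alpha>\<close> has slopes \<open>\<alpha>\<close> and \<open>1 - \<alpha>\<close> only, the map
  \<open>\<theta> \<mapsto> E \<ell>\<^sub>\<alpha> (V - \<theta>)\<close> is Lipschitz and decreases at a rate bounded away from zero, so it has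
  exactly one zero, and that zero is the expectile (\<open>expected_score_expectile\<close>,
  \<open>expectile_le_iff\<close>, \<open>le_expectile_iff\<close>).

  Each property of expectiles is then the expectation of a pointwise property of \<open>\<ell>\<^sub>\<alpha>\<close>, evaluated
  at the zero of one side: \<open>\<ell>\<^sub>\<alpha> t\<close> is nondecreasing in \<open>t\<close> (monotonicity in \<open>V\<close>) and in \<open>\<alpha>\<close>
  (nestedness), and it is concave, hence superadditive, for \<open>\<alpha> \<le> 1/2\<close>, and convex, hence
  subadditive, for \<open>\<alpha> \<ge> 1/2\<close>.

  Finally, a halfspace \<open>{z. u \<bullet> z \<ge> c}\<close> shrinks as \<open>c\<close> grows, and for a unit vector \<open>u\<close> every point
  can be moved along \<open>u\<close> to change \<open>u \<bullet> z\<close> by a prescribed amount. This turns inequalities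
  between expectiles into inclusions of Minkowski sums.
\<close>

section \<open>The asymmetric score\<close>

text \<open>
  Half the derivative of the asymmetric squared loss \<open>\<alpha> (t\<^sup>+)\<^sup>2 + (1 - \<alpha>) (t\<^sup>-)\<^sup>2\<close>.
\<close>

definition score :: "real \<Rightarrow> real \<Rightarrow> real" where
  "score \<alpha> t = \<alpha> * max t 0 - (1 - \<alpha>) * max (- t) 0"

lemma score_altdef: "score \<alpha> t = (if t \<ge> 0 then \<alpha> * t else (1 - \<alpha>) * t)"
  by (auto simp: score_def max_def algebra_simps)

text \<open>
  Passing from \<open>s\<close> to \<open>t\<close> adds to the positive part with weight \<open>\<alpha>\<close> and removes from the negative
  part with weight \<open>1 - \<alpha>\<close>, so both slopes are at least \<open>c\<close>. The choice \<open>c = 0\<close> gives monotonicity,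
  and \<open>c = min \<alpha> (1 - \<alpha>)\<close> the growth rate that locates the expectile.
\<close>

lemma score_diff_ge:
  assumes "s \<le> t" "c \<le> \<alpha>" "c \<le> 1 - \<alpha>"
  shows "c * (t - s) \<le> score \<alpha> t - score \<alpha> s"
proof -
  have 1: "c * (max t 0 - max s 0) \<le> \<alpha> * (max t 0 - max s 0)"
    using assms by (intro mult_right_mono) auto
  have 2: "c * (max (- s) 0 - max (- t) 0) \<le> (1 - \<alpha>) * (max (- s) 0 - max (- t) 0)"
    using assms by (intro mult_right_mono) auto
  have "t - s = (max t 0 - max s 0) + (max (- s) 0 - max (- t) 0)" by auto
  hence "c * (t - s) = c * (max t 0 - max s 0) + c * (max (- s) 0 - max (- t) 0)"
    by (simp add: distrib_left)
  also have "\<dots> \<le> \<alpha> * (max t 0 - max s 0) + (1 - \<alpha>) * (max (- s) 0 - max (- t) 0)"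
    using 1 2 by linarith
  also have "\<dots> = score \<alpha> t - score \<alpha> s"
    by (simp add: score_def right_diff_distrib)
  finally show ?thesis .
qed

text \<open>The identity \<open>\<ell>\<^sub>\<alpha> t + \<ell>\<^bsub>1-\<alpha>\<^esub> t = t\<close> turns the lower bound on slopes into an upper bound.\<close>

lemma score_diff_le:
  assumes "s \<le> t" "0 \<le> \<alpha>" "\<alpha> \<le> 1"
  shows "score \<alpha> t - score \<alpha> s \<le> t - s"
proof -
  have *: "score \<alpha> r + score (1 - \<alpha>) r = r" for r
    by (simp add: score_altdef algebra_simps)
  show ?thesis
    using score_diff_ge[of s t 0 "1 - \<alpha>"] assms *[of s] *[of t] by simp
qed

lemma score_mono: "0 \<le> \<alpha> \<Longrightarrow> \<alpha> \<le> 1 \<Longrightarrow> s \<le> t \<Longrightarrow> score \<alpha> s \<le> score \<alpha> t"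
  using score_diff_ge[of s t 0 \<alpha>] by simp

lemma score_mono_level:
  assumes "\<alpha> \<le> \<beta>"
  shows "score \<alpha> t \<le> score \<beta> t"
  using assms by (auto simp: score_altdef mult_right_mono mult_right_mono_neg)

text \<open>
  For \<open>\<alpha> \<le> 1/2\<close> the slope drops from \<open>1 - \<alpha>\<close> to \<open>\<alpha>\<close> at the origin. As a minimum of linear
  functions the score is superadditive; subadditivity for \<open>\<alpha> \<ge> 1/2\<close> follows by the reflection
  \<open>score_neg\<close>, which exchanges \<open>\<alpha>\<close> and \<open>1 - \<alpha>\<close>.
\<close>

lemma score_eq_min:
  assumes "\<alpha> \<le> 1/2"
  shows "score \<alpha> t = min (\<alpha> * t) ((1 - \<alpha>) * t)"
proof (cases "t \<ge> 0")
  case True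
  have "\<alpha> * t \<le> (1 - \<alpha>) * t" using assms True by (intro mult_right_mono) auto
  with True show ?thesis by (simp add: score_altdef)
next
  case False
  have "(1 - \<alpha>) * t \<le> \<alpha> * t" using assms False by (intro mult_right_mono_neg) auto
  with False show ?thesis by (simp add: score_altdef)
qed

lemma score_superadditive:
  assumes "\<alpha> \<le> 1/2"
  shows "score \<alpha> s + score \<alpha> t \<le> score \<alpha> (s + t)"
  by (auto simp: score_eq_min[OF assms] min_def distrib_left)

lemma score_neg: "score \<alpha> (- t) = - score (1 - \<alpha>) t"
  by (simp add: score_def)

lemma score_subadditive:
  assumes "\<alpha> \<ge> 1/2"
  shows "score \<alpha> (s + t) \<le> score \<alpha> s + score \<alpha> t"
proof -
  have "score (1 - \<alpha>) (- s) + score (1 - \<alpha>) (- t) \<le> score (1 - \<alpha>) (- (s + t))"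
    using score_superadditive[of "1 - \<alpha>" "- s" "- t"] assms by simp
  thus ?thesis unfolding score_neg by simp
qed

section \<open>The expectile as the zero of the expected score\<close>

context prob_space
begin

lemma integrable_score:
  assumes "integrable M V"
  shows "integrable M (\<lambda>\<omega>. score \<alpha> (V \<omega> - \<theta>))"
  unfolding score_def using assms
  by (intro Bochner_Integration.integrable_diff integrable_mult_right integrable_max) auto

text \<open>
  Since \<open>\<ell>\<^sub>\<alpha> t = \<alpha> \<bar>t\<bar> - t\<^sup>-\<close>, the defining inequality of the expectile becomes \<open>E \<ell>\<^sub>\<alpha> (V - \<theta>) \<le> 0\<close>
  after multiplication by \<open>E \<bar>V - \<theta>\<bar>\<close>, which is positive because \<open>V\<close> is not almost surely equal
  to \<open>\<theta>\<close>.
\<close>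

lemma expectile_eq_Inf_score:
  assumes V: "integrable M V" and nd: "\<And>\<theta>. \<not> (AE \<omega> in M. V \<omega> = \<theta>)"
  shows "expectile M \<alpha> V = Inf {\<theta>. expectation (\<lambda>\<omega>. score \<alpha> (V \<omega> - \<theta>)) \<le> 0}"
proof -
  have "(expectation (\<lambda>\<omega>. \<bar>V \<omega> - \<theta>\<bar> * indicator {\<omega>. V \<omega> \<le> \<theta>} \<omega>) / expectation (\<lambda>\<omega>. \<bar>V \<omega> - \<theta>\<bar>) \<ge> \<alpha>)
        \<longleftrightarrow> expectation (\<lambda>\<omega>. score \<alpha> (V \<omega> - \<theta>)) \<le> 0" (is "?B / ?D \<ge> \<alpha> \<longleftrightarrow> _") for \<theta>
  proof -
    have D: "integrable M (\<lambda>\<omega>. \<bar>V \<omega> - \<theta>\<bar>)"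
      using V by auto
    have "?D \<noteq> 0"
    proof
      assume "?D = 0"
      hence "AE \<omega> in M. \<bar>V \<omega> - \<theta>\<bar> = 0"
        using D by (subst (asm) integral_nonneg_eq_0_iff_AE) auto
      thus False using nd[of \<theta>] by auto
    qed
    hence "?D > 0" by (simp add: less_le)
    have ind: "(\<lambda>\<omega>. \<bar>V \<omega> - \<theta>\<bar> * indicator {\<omega>. V \<omega> \<le> \<theta>} \<omega>) = (\<lambda>\<omega>. max (\<theta> - V \<omega>) 0)"
      by (auto simp: indicator_def max_def)
    have B: "integrable M (\<lambda>\<omega>. max (\<theta> - V \<omega>) 0)"
      using V by (intro integrable_max) auto
    have "score \<alpha> t = \<alpha> * \<bar>t\<bar> - max (- t) 0" for t
      by (auto simp: score_altdef max_def algebra_simps)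
    hence "expectation (\<lambda>\<omega>. score \<alpha> (V \<omega> - \<theta>)) = \<alpha> * ?D - ?B"
      unfolding ind using B D by simp
    thus ?thesis using \<open>?D > 0\<close> by (simp add: pos_le_divide_eq)
  qed
  thus ?thesis unfolding expectile_def by simp
qed

lemma expected_score_decreasing:
  assumes V: "integrable M V" and "\<theta> \<le> \<eta>" "c \<le> \<alpha>" "c \<le> 1 - \<alpha>"
  shows "expectation (\<lambda>\<omega>. score \<alpha> (V \<omega> - \<eta>)) + c * (\<eta> - \<theta>)
           \<le> expectation (\<lambda>\<omega>. score \<alpha> (V \<omega> - \<theta>))"
proof -
  have "expectation (\<lambda>\<omega>. score \<alpha> (V \<omega> - \<eta>) + c * (\<eta> - \<theta>))
          \<le> expectation (\<lambda>\<omega>. score \<alpha> (V \<omega> - \<theta>))"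
  proof (intro integral_mono)
    fix \<omega>
    show "score \<alpha> (V \<omega> - \<eta>) + c * (\<eta> - \<theta>) \<le> score \<alpha> (V \<omega> - \<theta>)"
      using score_diff_ge[of "V \<omega> - \<eta>" "V \<omega> - \<theta>" c \<alpha>] assms by simp
  qed (use V in \<open>auto intro!: integrable_score\<close>)
  thus ?thesis using V by (simp add: integrable_score prob_space)
qed

lemma expected_score_strict_decreasing:
  assumes V: "integrable M V" and \<alpha>: "0 < \<alpha>" "\<alpha> < 1" and "\<theta> < \<eta>"
  shows "expectation (\<lambda>\<omega>. score \<alpha> (V \<omega> - \<eta>)) < expectation (\<lambda>\<omega>. score \<alpha> (V \<omega> - \<theta>))"
proof -
  have "min \<alpha> (1 - \<alpha>) * (\<eta> - \<theta>) > 0" using \<alpha> \<open>\<theta> < \<eta>\<close> by auto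
  moreover have "expectation (\<lambda>\<omega>. score \<alpha> (V \<omega> - \<eta>)) + min \<alpha> (1 - \<alpha>) * (\<eta> - \<theta>)
      \<le> expectation (\<lambda>\<omega>. score \<alpha> (V \<omega> - \<theta>))"
    using \<open>\<theta> < \<eta>\<close> by (intro expected_score_decreasing[OF V]) auto
  ultimately show ?thesis by linarith
qed

lemma expected_score_lipschitz:
  assumes V: "integrable M V" and "\<theta> \<le> \<eta>" "0 \<le> \<alpha>" "\<alpha> \<le> 1"
  shows "expectation (\<lambda>\<omega>. score \<alpha> (V \<omega> - \<theta>))
           \<le> expectation (\<lambda>\<omega>. score \<alpha> (V \<omega> - \<eta>)) + (\<eta> - \<theta>)"
proof -
  have "expectation (\<lambda>\<omega>. score \<alpha> (V \<omega> - \<theta>))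
          \<le> expectation (\<lambda>\<omega>. score \<alpha> (V \<omega> - \<eta>) + (\<eta> - \<theta>))"
  proof (intro integral_mono)
    fix \<omega>
    show "score \<alpha> (V \<omega> - \<theta>) \<le> score \<alpha> (V \<omega> - \<eta>) + (\<eta> - \<theta>)"
      using score_diff_le[of "V \<omega> - \<eta>" "V \<omega> - \<theta>" \<alpha>] assms by simp
  qed (use V in \<open>auto intro!: integrable_score\<close>)
  thus ?thesis using V by (simp add: integrable_score prob_space)
qed

lemma ex_zero_expected_score:
  assumes V: "integrable M V" and \<alpha>: "0 < \<alpha>" "\<alpha> < 1"
  shows "\<exists>\<theta>. expectation (\<lambda>\<omega>. score \<alpha> (V \<omega> - \<theta>)) = 0"
proof -
  define \<psi> where "\<psi> \<theta> = expectation (\<lambda>\<omega>. score \<alpha> (V \<omega> - \<theta>))" for \<theta>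
  define c where "c = min \<alpha> (1 - \<alpha>)"
  have c: "c > 0" "c \<le> \<alpha>" "c \<le> 1 - \<alpha>" using \<alpha> by (auto simp: c_def)
  have dec: "\<psi> \<eta> + c * (\<eta> - \<theta>) \<le> \<psi> \<theta>" if "\<theta> \<le> \<eta>" for \<theta> \<eta>
    unfolding \<psi>_def using expected_score_decreasing[OF V that c(2,3)] .
  have lip: "\<psi> \<theta> \<le> \<psi> \<eta> + (\<eta> - \<theta>)" if "\<theta> \<le> \<eta>" for \<theta> \<eta>
    unfolding \<psi>_def using expected_score_lipschitz[OF V that] \<alpha> by simp
  have anti: "\<psi> \<eta> \<le> \<psi> \<theta>" if "\<theta> \<le> \<eta>" for \<theta> \<eta>
    using dec[OF that] mult_nonneg_nonneg[of c "\<eta> - \<theta>"] c that by linarith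
  have "dist (\<psi> x) (\<psi> y) \<le> 1 * dist x y" for x y
    using lip[of x y] lip[of y x] anti[of x y] anti[of y x] by (cases "x \<le> y") (auto simp: dist_real_def)
  hence "1-lipschitz_on UNIV \<psi>" by (intro lipschitz_onI) auto
  hence cont: "continuous_on UNIV \<psi>" by (rule lipschitz_on_continuous_on)
  \<comment> \<open>Descending at rate at least \<open>c\<close> from height \<open>\<psi> 0\<close>, the function has reached zero at
      distance \<open>\<bar>\<psi> 0\<bar> / c\<close> to the right of the origin; the same bound works to the left.\<close>
  define r where "r = \<bar>\<psi> 0\<bar> / c"
  have r: "r \<ge> 0" "c * r = \<bar>\<psi> 0\<bar>" using c by (auto simp: r_def)
  have "\<psi> r \<le> 0" "\<psi> (- r) \<ge> 0" using dec[of 0 r] dec[of "- r" 0] r by auto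
  hence "\<exists>x. - r \<le> x \<and> x \<le> r \<and> \<psi> x = 0"
    using r(1) by (intro IVT2' continuous_on_subset[OF cont]) auto
  thus ?thesis unfolding \<psi>_def by blast
qed

text \<open>
  A zero \<open>e\<close> of the strictly decreasing expected score makes the set under the infimum equal
  to \<open>{e..}\<close>.
\<close>

lemma expectile_eqI:
  assumes V: "integrable M V" and nd: "\<And>\<theta>. \<not> (AE \<omega> in M. V \<omega> = \<theta>)"
    and \<alpha>: "0 < \<alpha>" "\<alpha> < 1"
    and zero: "expectation (\<lambda>\<omega>. score \<alpha> (V \<omega> - e)) = 0"
  shows "expectile M \<alpha> V = e"
proof -
  have "expectation (\<lambda>\<omega>. score \<alpha> (V \<omega> - \<theta>)) \<le> 0 \<longleftrightarrow> e \<le> \<theta>" for \<theta>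
    using zero expected_score_strict_decreasing[OF V \<alpha>, of e \<theta>]
      expected_score_strict_decreasing[OF V \<alpha>, of \<theta> e]
    by (cases e \<theta> rule: linorder_cases) auto
  hence "{\<theta>. expectation (\<lambda>\<omega>. score \<alpha> (V \<omega> - \<theta>)) \<le> 0} = {e..}" by auto
  thus ?thesis by (simp add: expectile_eq_Inf_score[OF V nd])
qed

lemma expected_score_expectile:
  assumes V: "integrable M V" and nd: "\<And>\<theta>. \<not> (AE \<omega> in M. V \<omega> = \<theta>)"
    and \<alpha>: "0 < \<alpha>" "\<alpha> < 1"
  shows "expectation (\<lambda>\<omega>. score \<alpha> (V \<omega> - expectile M \<alpha> V)) = 0"
  using ex_zero_expected_score[OF V \<alpha>] expectile_eqI[OF V nd \<alpha>] by metis

lemma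
  assumes V: "integrable M V" and nd: "\<And>\<theta>. \<not> (AE \<omega> in M. V \<omega> = \<theta>)"
    and \<alpha>: "0 < \<alpha>" "\<alpha> < 1"
  shows expectile_le_iff:
      "expectile M \<alpha> V \<le> \<theta> \<longleftrightarrow> expectation (\<lambda>\<omega>. score \<alpha> (V \<omega> - \<theta>)) \<le> 0"
    and le_expectile_iff:
      "\<theta> \<le> expectile M \<alpha> V \<longleftrightarrow> 0 \<le> expectation (\<lambda>\<omega>. score \<alpha> (V \<omega> - \<theta>))"
proof -
  show "expectile M \<alpha> V \<le> \<theta> \<longleftrightarrow> expectation (\<lambda>\<omega>. score \<alpha> (V \<omega> - \<theta>)) \<le> 0"
    and "\<theta> \<le> expectile M \<alpha> V \<longleftrightarrow> 0 \<le> expectation (\<lambda>\<omega>. score \<alpha> (V \<omega> - \<theta>))"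
    using expected_score_expectile[OF V nd \<alpha>]
      expected_score_strict_decreasing[OF V \<alpha>, of "expectile M \<alpha> V" \<theta>]
      expected_score_strict_decreasing[OF V \<alpha>, of \<theta> "expectile M \<alpha> V"]
    by (cases "expectile M \<alpha> V" \<theta> rule: linorder_cases; simp)+
qed

section \<open>Properties of univariate expectiles\<close>

text \<open>
  Here and in the next three lemmas the expected scores are compared at the point where one side
  is known to vanish, and the sign obtained for the other side places its expectile.
\<close>

lemma expectile_mono:
  assumes V: "integrable M V" "\<And>\<theta>. \<not> (AE \<omega> in M. V \<omega> = \<theta>)"
    and W: "integrable M W" "\<And>\<theta>. \<not> (AE \<omega> in M. W \<omega> = \<theta>)"
    and \<alpha>: "0 < \<alpha>" "\<alpha> < 1" and le: "AE \<omega> in M. V \<omega> \<le> W \<omega>"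
  shows "expectile M \<alpha> V \<le> expectile M \<alpha> W"
proof -
  let ?e = "expectile M \<alpha> W"
  have "expectation (\<lambda>\<omega>. score \<alpha> (V \<omega> - ?e)) \<le> expectation (\<lambda>\<omega>. score \<alpha> (W \<omega> - ?e))"
    using le \<alpha> by (intro integral_mono_AE integrable_score V W) (auto intro!: score_mono)
  also have "\<dots> = 0" by (rule expected_score_expectile[OF W \<alpha>])
  finally show ?thesis by (simp add: expectile_le_iff[OF V \<alpha>])
qed

lemma expectile_mono_level:
  assumes V: "integrable M V" "\<And>\<theta>. \<not> (AE \<omega> in M. V \<omega> = \<theta>)"
    and \<alpha>: "0 < \<alpha>" "\<alpha> \<le> \<beta>" "\<beta> < 1"
  shows "expectile M \<alpha> V \<le> expectile M \<beta> V"
proof -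
  let ?e = "expectile M \<beta> V"
  have "expectation (\<lambda>\<omega>. score \<alpha> (V \<omega> - ?e)) \<le> expectation (\<lambda>\<omega>. score \<beta> (V \<omega> - ?e))"
    using \<alpha> by (intro integral_mono integrable_score V score_mono_level)
  also have "\<dots> = 0" using \<alpha> by (intro expected_score_expectile[OF V]) auto
  finally show ?thesis using \<alpha> by (subst expectile_le_iff[OF V]) auto
qed

lemma expectile_superadditive:
  assumes V: "integrable M V" "\<And>\<theta>. \<not> (AE \<omega> in M. V \<omega> = \<theta>)"
    and W: "integrable M W" "\<And>\<theta>. \<not> (AE \<omega> in M. W \<omega> = \<theta>)"
    and S: "\<And>\<theta>. \<not> (AE \<omega> in M. V \<omega> + W \<omega> = \<theta>)"
    and \<alpha>: "0 < \<alpha>" "\<alpha> \<le> 1/2"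
  shows "expectile M \<alpha> V + expectile M \<alpha> W \<le> expectile M \<alpha> (\<lambda>\<omega>. V \<omega> + W \<omega>)"
proof -
  let ?v = "expectile M \<alpha> V" and ?w = "expectile M \<alpha> W"
  have \<alpha>1: "\<alpha> < 1" using \<alpha> by simp
  have I: "integrable M (\<lambda>\<omega>. V \<omega> + W \<omega>)" using V W by simp
  have "0 = expectation (\<lambda>\<omega>. score \<alpha> (V \<omega> - ?v) + score \<alpha> (W \<omega> - ?w))"
    using V W \<alpha> \<alpha>1 by (simp add: integrable_score expected_score_expectile)
  also have "\<dots> \<le> expectation (\<lambda>\<omega>. score \<alpha> (V \<omega> + W \<omega> - (?v + ?w)))"
  proof (intro integral_mono Bochner_Integration.integrable_add integrable_score V W)
    fix \<omega>
    show "score \<alpha> (V \<omega> - ?v) + score \<alpha> (W \<omega> - ?w) \<le> score \<alpha> (V \<omega> + W \<omega> - (?v + ?w))"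
      using score_superadditive[OF \<alpha>(2), of "V \<omega> - ?v" "W \<omega> - ?w"] by (simp add: algebra_simps)
  qed
  finally show ?thesis by (simp add: le_expectile_iff[OF I S \<alpha>(1) \<alpha>1])
qed

lemma expectile_subadditive:
  assumes V: "integrable M V" "\<And>\<theta>. \<not> (AE \<omega> in M. V \<omega> = \<theta>)"
    and W: "integrable M W" "\<And>\<theta>. \<not> (AE \<omega> in M. W \<omega> = \<theta>)"
    and S: "\<And>\<theta>. \<not> (AE \<omega> in M. V \<omega> + W \<omega> = \<theta>)"
    and \<alpha>: "1/2 \<le> \<alpha>" "\<alpha> < 1"
  shows "expectile M \<alpha> (\<lambda>\<omega>. V \<omega> + W \<omega>) \<le> expectile M \<alpha> V + expectile M \<alpha> W"
proof -
  let ?v = "expectile M \<alpha> V" and ?w = "expectile M \<alpha> W"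
  have \<alpha>0: "0 < \<alpha>" using \<alpha> by simp
  have I: "integrable M (\<lambda>\<omega>. V \<omega> + W \<omega>)" using V W by simp
  have "expectation (\<lambda>\<omega>. score \<alpha> (V \<omega> + W \<omega> - (?v + ?w)))
          \<le> expectation (\<lambda>\<omega>. score \<alpha> (V \<omega> - ?v) + score \<alpha> (W \<omega> - ?w))"
  proof (intro integral_mono Bochner_Integration.integrable_add integrable_score V W)
    fix \<omega>
    show "score \<alpha> (V \<omega> + W \<omega> - (?v + ?w)) \<le> score \<alpha> (V \<omega> - ?v) + score \<alpha> (W \<omega> - ?w)"
      using score_subadditive[OF \<alpha>(1), of "V \<omega> - ?v" "W \<omega> - ?w"] by (simp add: algebra_simps)
  qed
  also have "\<dots> = 0"
    using V W \<alpha> \<alpha>0 by (simp add: integrable_score expected_score_expectile)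
  finally show ?thesis by (simp add: expectile_le_iff[OF I S \<alpha>0 \<alpha>(2)])
qed

section \<open>Projections and halfspaces\<close>

lemma integrable_inner_expectile_class:
  fixes Z :: "'a \<Rightarrow> real ^ 'n"
  assumes [measurable]: "Z \<in> borel_measurable M" and P: "distr M borel Z \<in> expectile_class"
  shows "integrable M (\<lambda>\<omega>. u \<bullet> Z \<omega>)"
proof -
  have "integrable M (\<lambda>\<omega>. norm (Z \<omega>))"
    using P by (simp add: expectile_class_def integrable_distr_eq)
  hence "integrable M Z" by (simp add: integrable_norm_iff)
  thus ?thesis by simp
qed

lemma nondegenerate_inner_expectile_class:
  fixes Z :: "'a \<Rightarrow> real ^ 'n"
  assumes Z [measurable]: "Z \<in> borel_measurable M" and P: "distr M borel Z \<in> expectile_class"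
    and "u \<noteq> 0"
  shows "\<not> (AE \<omega> in M. u \<bullet> Z \<omega> = \<theta>)"
proof
  assume "AE \<omega> in M. u \<bullet> Z \<omega> = \<theta>"
  hence "prob {\<omega> \<in> space M. u \<bullet> Z \<omega> = \<theta>} = 1"
    by (subst prob_Collect_eq_1) auto
  moreover have "measure (distr M borel Z) {z. u \<bullet> z = \<theta>} = prob {\<omega> \<in> space M. u \<bullet> Z \<omega> = \<theta>}"
    by (subst measure_distr) (auto intro!: arg_cong[where f = prob])
  ultimately show False using P \<open>u \<noteq> 0\<close> by (simp add: expectile_class_def)
qed

end

text \<open>
  A point \<open>z\<close> with \<open>u \<bullet> z \<ge> a + b\<close> splits as \<open>(z - b u) + b u\<close>, where \<open>u \<bullet> b u = b\<close>.
\<close>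

lemma halfspace_sum_eq:
  fixes u :: "'a :: real_inner"
  assumes "norm u = 1"
  shows "{z. a \<le> u \<bullet> z} + {z. b \<le> u \<bullet> z} = {z. a + b \<le> u \<bullet> z}"
proof (intro equalityI subsetI)
  fix z assume "z \<in> {z. a + b \<le> u \<bullet> z}"
  moreover have "u \<bullet> u = 1" using assms by (simp add: norm_eq_1)
  ultimately have "z - b *\<^sub>R u \<in> {z. a \<le> u \<bullet> z}" "b *\<^sub>R u \<in> {z. b \<le> u \<bullet> z}"
    by (auto simp: inner_diff_right)
  hence "(z - b *\<^sub>R u) + b *\<^sub>R u \<in> {z. a \<le> u \<bullet> z} + {z. b \<le> u \<bullet> z}" by (rule set_plus_intro)
  thus "z \<in> {z. a \<le> u \<bullet> z} + {z. b \<le> u \<bullet> z}" by simp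
qed (auto elim!: set_plus_elim simp: inner_add_right)

lemma halfspace_subset_plus_nonneg_orthant:
  fixes u :: "real ^ 'n"
  assumes "a \<le> b"
  shows "{z. b \<le> u \<bullet> z} \<subseteq> {z. a \<le> u \<bullet> z} + nonneg_orthant"
proof
  fix z assume "z \<in> {z. b \<le> u \<bullet> z}"
  hence "z + 0 \<in> {z. a \<le> u \<bullet> z} + nonneg_orthant"
    using assms by (intro set_plus_intro) (auto simp: nonneg_orthant_def)
  thus "z \<in> {z. a \<le> u \<bullet> z} + nonneg_orthant" by simp
qed

text \<open>
  Moving a point by \<open>b - a\<close> along \<open>u\<close> brings it into the smaller halfspace, and the way back is a
  nonpositive vector because \<open>u\<close> lies in the nonnegative orthant.
\<close>

lemma halfspace_subset_plus_nonpos_orthant: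
  fixes u :: "real ^ 'n"
  assumes "norm u = 1" "u \<in> nonneg_orthant" "a \<le> b"
  shows "{z. a \<le> u \<bullet> z} \<subseteq> {z. b \<le> u \<bullet> z} + nonpos_orthant"
proof
  fix z assume "z \<in> {z. a \<le> u \<bullet> z}"
  moreover have "u \<bullet> u = 1" using assms by (simp add: norm_eq_1)
  ultimately have "z + (b - a) *\<^sub>R u \<in> {z. b \<le> u \<bullet> z}" by (simp add: inner_add_right)
  moreover have "- ((b - a) *\<^sub>R u) \<in> nonpos_orthant"
    using assms by (simp add: nonneg_orthant_def nonpos_orthant_def)
  ultimately have "(z + (b - a) *\<^sub>R u) + - ((b - a) *\<^sub>R u) \<in> {z. b \<le> u \<bullet> z} + nonpos_orthant"
    by (rule set_plus_intro)
  thus "z \<in> {z. b \<le> u \<bullet> z} + nonpos_orthant" by simp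
qed

section \<open>Expectile halfspaces\<close>

theorem theorem6p1:
  fixes M :: "'w measure" and X Y :: "'w \<Rightarrow> real ^ 'n"
  assumes "prob_space M"
    and "X \<in> borel_measurable M" and "Y \<in> borel_measurable M"
    and "distr M borel X \<in> expectile_class" and "distr M borel Y \<in> expectile_class"
  shows
    "((AE \<omega> in M. \<forall>i. X \<omega> $ i \<le> Y \<omega> $ i) \<longrightarrow>
        (\<forall>\<alpha>\<in>{0<..<1}. \<forall>u\<in>sphere 0 1 \<inter> nonneg_orthant.
          expectile_halfspace M \<alpha> u Y \<subseteq> expectile_halfspace M \<alpha> u X + nonneg_orthant \<and>
          expectile_halfspace M \<alpha> u X \<subseteq> expectile_halfspace M \<alpha> u Y + nonpos_orthant))
     \<and>
     (distr M borel (\<lambda>\<omega>. X \<omega> + Y \<omega>) \<in> expectile_class \<longrightarrow>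
        (\<forall>\<alpha>\<in>{0<..1/2}. \<forall>u\<in>sphere 0 1.
          expectile_halfspace M \<alpha> u (\<lambda>\<omega>. X \<omega> + Y \<omega>)
            \<subseteq> expectile_halfspace M \<alpha> u X + expectile_halfspace M \<alpha> u Y))
     \<and>
     (distr M borel (\<lambda>\<omega>. X \<omega> + Y \<omega>) \<in> expectile_class \<longrightarrow>
        (\<forall>\<alpha>\<in>{1/2..<1}. \<forall>u\<in>sphere 0 1.
          expectile_halfspace M \<alpha> u X + expectile_halfspace M \<alpha> u Y
            \<subseteq> expectile_halfspace M \<alpha> u (\<lambda>\<omega>. X \<omega> + Y \<omega>)))
     \<and>
     (\<forall>u\<in>sphere 0 1. antimono_on {0<..<1} (\<lambda>\<alpha>. expectile_halfspace M \<alpha> u X))"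
proof -
  interpret prob_space M by fact
  note halfspace = expectile_halfspace_def
  have u_nz: "u \<noteq> 0" if "u \<in> sphere 0 1" for u :: "real ^ 'n" using that by auto
  note X = integrable_inner_expectile_class[OF assms(2,4)]
    nondegenerate_inner_expectile_class[OF assms(2,4) u_nz]
  note Y = integrable_inner_expectile_class[OF assms(3,5)]
    nondegenerate_inner_expectile_class[OF assms(3,5) u_nz]
  have S: "\<not> (AE \<omega> in M. u \<bullet> X \<omega> + u \<bullet> Y \<omega> = \<theta>)"
    if "distr M borel (\<lambda>\<omega>. X \<omega> + Y \<omega>) \<in> expectile_class" "u \<in> sphere 0 1" for u \<theta>
    using nondegenerate_inner_expectile_class[OF borel_measurable_add[OF assms(2,3)] that(1)
        u_nz[OF that(2)]]
    by (simp add: inner_add_right)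
  show ?thesis
  proof (intro conjI impI ballI)
    fix \<alpha> :: real and u :: "real ^ 'n"
    assume le: "AE \<omega> in M. \<forall>i. X \<omega> $ i \<le> Y \<omega> $ i" and \<alpha>: "\<alpha> \<in> {0<..<1}"
      and u: "u \<in> sphere 0 1 \<inter> nonneg_orthant"
    have "AE \<omega> in M. u \<bullet> X \<omega> \<le> u \<bullet> Y \<omega>"
      using le
    proof eventually_elim
      case (elim \<omega>)
      thus ?case using u
        by (auto simp: inner_vec_def nonneg_orthant_def intro!: sum_mono mult_left_mono)
    qed
    hence e: "expectile M \<alpha> (\<lambda>\<omega>. u \<bullet> X \<omega>) \<le> expectile M \<alpha> (\<lambda>\<omega>. u \<bullet> Y \<omega>)"
      using \<alpha> u by (intro expectile_mono X Y) auto
    show "expectile_halfspace M \<alpha> u Y \<subseteq> expectile_halfspace M \<alpha> u X + nonneg_orthant"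
      unfolding halfspace using e by (rule halfspace_subset_plus_nonneg_orthant)
    show "expectile_halfspace M \<alpha> u X \<subseteq> expectile_halfspace M \<alpha> u Y + nonpos_orthant"
      unfolding halfspace using u e by (intro halfspace_subset_plus_nonpos_orthant) auto
  next
    fix \<alpha> :: real and u :: "real ^ 'n"
    assume XY: "distr M borel (\<lambda>\<omega>. X \<omega> + Y \<omega>) \<in> expectile_class"
      and \<alpha>: "\<alpha> \<in> {0<..1/2}" and u: "u \<in> sphere 0 1"
    have "expectile M \<alpha> (\<lambda>\<omega>. u \<bullet> X \<omega>) + expectile M \<alpha> (\<lambda>\<omega>. u \<bullet> Y \<omega>)
            \<le> expectile M \<alpha> (\<lambda>\<omega>. u \<bullet> X \<omega> + u \<bullet> Y \<omega>)"
      using \<alpha> u by (intro expectile_superadditive X Y S[OF XY]) auto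
    thus "expectile_halfspace M \<alpha> u (\<lambda>\<omega>. X \<omega> + Y \<omega>)
            \<subseteq> expectile_halfspace M \<alpha> u X + expectile_halfspace M \<alpha> u Y"
      using u by (auto simp: halfspace halfspace_sum_eq inner_add_right)
  next
    fix \<alpha> :: real and u :: "real ^ 'n"
    assume XY: "distr M borel (\<lambda>\<omega>. X \<omega> + Y \<omega>) \<in> expectile_class"
      and \<alpha>: "\<alpha> \<in> {1/2..<1}" and u: "u \<in> sphere 0 1"
    have "expectile M \<alpha> (\<lambda>\<omega>. u \<bullet> X \<omega> + u \<bullet> Y \<omega>)
            \<le> expectile M \<alpha> (\<lambda>\<omega>. u \<bullet> X \<omega>) + expectile M \<alpha> (\<lambda>\<omega>. u \<bullet> Y \<omega>)"
      using \<alpha> u by (intro expectile_subadditive X Y S[OF XY]) auto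
    thus "expectile_halfspace M \<alpha> u X + expectile_halfspace M \<alpha> u Y
            \<subseteq> expectile_halfspace M \<alpha> u (\<lambda>\<omega>. X \<omega> + Y \<omega>)"
      using u by (auto simp: halfspace halfspace_sum_eq inner_add_right)
  next
    fix u :: "real ^ 'n"
    assume u: "u \<in> sphere 0 1"
    show "antimono_on {0<..<1} (\<lambda>\<alpha>. expectile_halfspace M \<alpha> u X)"
    proof (rule monotone_onI)
      fix \<alpha> \<beta> :: real
      assume "\<alpha> \<in> {0<..<1}" "\<beta> \<in> {0<..<1}" "\<alpha> \<le> \<beta>"
      hence "expectile M \<alpha> (\<lambda>\<omega>. u \<bullet> X \<omega>) \<le> expectile M \<beta> (\<lambda>\<omega>. u \<bullet> X \<omega>)"
        using u by (intro expectile_mono_level X) auto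
      thus "expectile_halfspace M \<beta> u X \<le> expectile_halfspace M \<alpha> u X"
        by (auto simp: halfspace)
    qed
  qed
qed

end
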